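(* Let $\mu>0$, let $F:V\to\mathbb R$ be convex and continuously differentiable, and let $N:V\to V$ be $\mu$-strongly monotone, i.e. $(N(x)-N(y),x-y)\ge\mu\|x-y\|^2$ for all $x,y\in V$. Let $x^\star\in V$ satisfy $\nabla F(x^\star)+N(x^\star)=0$. Let $$\mathcal E(x,y)=D_F(x,x^\star)+\frac\mu2\|y-x^\star\|^2,\qquad \mathcal G(x,y)=\Big(y-x,\ -\tfrac1\mu\big(\nabla F(x)+N(y)\big)\Big).$$ Then for all $x,y\in V$ the following strong Lyapunov property holds: $$-\langle\nabla\mathcal E(x,y),\mathcal G(x,y)\rangle\ \ge\ \mathcal E(x,y)+D_F(x^\star,x)+\frac\mu2\|y-x^\star\|^2 .$$ Consequently, along every solution $(x(t),y(t))$, $t\ge0$, of the variable and operator splitting (VOS) flow $$x'=y-x,\qquad y'=-\frac1\mu\big(\nabla F(x)+N(y)\big),$$ one has $\mathcal E(x(t),y(t))\le \mathcal E(x(0),y(0))\,e^{-t}$ for all $t\ge 0$.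
   Context: $V$ is a real Hilbert space with inner product $(\cdot,\cdot)$ and norm $\|\cdot\|$, identified with its dual; $\langle\cdot,\cdot\rangle$ denotes the duality pairing (inner product on $V$ or on $V\times V$). The Bregman divergence is $D_F(y,x)=F(y)-F(x)-\langle\nabla F(x),y-x\rangle$. The gradient is $\nabla\mathcal E(x,y)=(\nabla F(x)-\nabla F(x^\star),\ \mu(y-x^\star))$. *)

theory Defs
  imports "HOL-Analysis.Analysis"
begin

text \<open>
  Real Hilbert spaces are types of sort \<open>{real_inner, complete_space}\<close>; the product type
  carries the inner product \<open>(a, b) \<bullet> (c, d) = a \<bullet> c + b \<bullet> d\<close>.
\<close>

definition continuously_differentiable :: "('a::real_normed_vector \<Rightarrow> real) \<Rightarrow> bool" where
  "continuously_differentiable F \<longleftrightarrow>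
     (\<exists>F' :: 'a \<Rightarrow> 'a \<Rightarrow>\<^sub>L real.
        (\<forall>x. (F has_derivative blinfun_apply (F' x)) (at x)) \<and> continuous_on UNIV F')"

text \<open>
  The Riesz representative of the Frechet derivative. In a Hilbert space it exists (and is unique)
  wherever the function is differentiable; elsewhere the value is unspecified.
\<close>

definition gradient :: "('a::real_inner \<Rightarrow> real) \<Rightarrow> 'a \<Rightarrow> 'a" where
  "gradient F x = (THE D. GDERIV F x :> D)"

definition bregman :: "('a::real_inner \<Rightarrow> real) \<Rightarrow> 'a \<Rightarrow> 'a \<Rightarrow> real" where
  "bregman F y x = F y - F x - gradient F x \<bullet> (y - x)"

definition strongly_monotone :: "real \<Rightarrow> ('a::real_inner \<Rightarrow> 'a) \<Rightarrow> bool" where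
  "strongly_monotone \<mu> N \<longleftrightarrow> (\<forall>x y. (N x - N y) \<bullet> (x - y) \<ge> \<mu> * (norm (x - y))\<^sup>2)"

definition lyapunov :: "real \<Rightarrow> ('a::real_inner \<Rightarrow> real) \<Rightarrow> 'a \<Rightarrow> 'a \<times> 'a \<Rightarrow> real" where
  "lyapunov \<mu> F xs = (\<lambda>(x, y). bregman F x xs + \<mu> / 2 * (norm (y - xs))\<^sup>2)"

definition vos_field ::
  "real \<Rightarrow> ('a::real_inner \<Rightarrow> real) \<Rightarrow> ('a \<Rightarrow> 'a) \<Rightarrow> 'a \<times> 'a \<Rightarrow> 'a \<times> 'a" where
  "vos_field \<mu> F N = (\<lambda>(x, y). (y - x, - (1 / \<mu>) *\<^sub>R (gradient F x + N y)))"

text \<open>Classical solutions on the half-line, with the one-sided derivative at time 0.\<close>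

definition vos_solution ::
  "real \<Rightarrow> ('a::real_inner \<Rightarrow> real) \<Rightarrow> ('a \<Rightarrow> 'a) \<Rightarrow> (real \<Rightarrow> 'a) \<Rightarrow> (real \<Rightarrow> 'a) \<Rightarrow> bool" where
  "vos_solution \<mu> F N x y \<longleftrightarrow>
     (\<forall>t\<ge>0. (x has_vector_derivative y t - x t) (at t within {0..}) \<and>
            (y has_vector_derivative - (1 / \<mu>) *\<^sub>R (gradient F (x t) + N (y t)))
              (at t within {0..}))"

end

theory Submission
  imports Defs
begin

text \<open>
  Write \<open>g = gradient F\<close>, \<open>E\<close> for the Lyapunov function and \<open>G\<close> for the VOS field. The
  equilibrium condition says \<open>N xs = - g xs\<close>, hence
  \<open>g x + N y = (g x - g xs) + (N y - N xs)\<close>. After this substitution the two occurrences of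
  \<open>(g x - g xs) \<bullet> y\<close> in \<open>- \<nabla>E \<bullet> G\<close>, one from each component of the field, cancel, and there remains
  \<^item> \<open>(g x - g xs) \<bullet> (x - xs)\<close>, which is exactly the symmetrised Bregman divergence
    \<open>bregman F x xs + bregman F xs x\<close> (lemma \<open>bregman_symmetrised\<close>), and
  \<^item> \<open>(N y - N xs) \<bullet> (y - xs)\<close>, which strong monotonicity bounds below by \<open>\<mu> * (norm (y - xs))\<^sup>2\<close>.

  One half of the last term goes into the Lyapunov function; this is the strong Lyapunov property.

  By the chain rule the derivative of the Lyapunov function along a solution is \<open>\<nabla>E \<bullet> G\<close>. The
  surplus terms \<open>bregman F xs x\<close> and \<open>\<mu> / 2 * (norm (y - xs))\<^sup>2\<close> are nonnegative, the first one
  because a convex function lies above its tangents. So the derivative is at most \<open>- E\<close>, and a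
  Gronwall argument gives the factor \<open>exp (- t)\<close>.

  All of this presupposes that \<open>gradient\<close>, a definite description, denotes the Riesz representative
  of the derivative. Uniqueness is elementary; existence is the Riesz representation theorem, the
  only place where completeness of the space enters. It is proved by minimising
  \<open>(norm u)\<^sup>2 - 2 * f u\<close>.
\<close>

section \<open>Riesz representation\<close>

text \<open>
  The functional \<open>J u = (norm u)\<^sup>2 - 2 * f u\<close> is strongly convex: by the parallelogram law
  \<open>J u + J v - 2 * J ((u + v) / 2) = (norm (u - v))\<^sup>2 / 2\<close>. Therefore minimising sequences are Cauchy,
  a minimiser exists, and the first-order condition at a minimiser \<open>u\<close> reads \<open>h \<bullet> u = f h\<close>.
\<close>

theorem Riesz_representation:
  fixes f :: "'a::{real_inner, complete_space} \<Rightarrow> real"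
  assumes f: "bounded_linear f"
  obtains u where "\<And>h. f h = h \<bullet> u"
proof -
  interpret f: bounded_linear f by (fact f)
  define J where "J u = (norm u)\<^sup>2 - 2 * f u" for u
  obtain K where K: "\<And>x. norm (f x) \<le> norm x * K"
    using f.bounded by blast
  have lower: "J u \<ge> - K\<^sup>2" for u
  proof -
    have "f u \<le> norm u * K" using K[of u] by simp
    moreover have "0 \<le> (norm u - K)\<^sup>2" by simp
    ultimately show ?thesis
      unfolding J_def by (simp add: power2_diff)
  qed
  have bdd: "bdd_below (range J)"
    using lower by (intro bdd_belowI[of _ "- K\<^sup>2"]) auto
  define m where "m = (INF u. J u)"
  have m_le: "m \<le> J u" for u
    unfolding m_def by (rule cINF_lower[OF bdd]) simp
  have "\<exists>u. J u < m + inverse (real (Suc n))" for n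
  proof -
    have "(INF u. J u) < m + inverse (real (Suc n))"
      by (simp add: m_def)
    then show ?thesis
      using cINF_less_iff[OF _ bdd] by auto
  qed
  then obtain X where X: "\<And>n. J (X n) < m + inverse (real (Suc n))"
    by metis
  have parallelogram: "(norm (u - v))\<^sup>2 \<le> 2 * (J u - m) + 2 * (J v - m)" for u v
  proof -
    define w where "w = (1/2) *\<^sub>R (u + v)"
    have "J u + J v - 2 * J w = (norm (u - v))\<^sup>2 / 2"
      unfolding J_def w_def power2_norm_eq_inner
      by (simp add: f.scaleR f.add inner_add inner_diff inner_commute algebra_simps)
    with m_le[of w] show ?thesis
      by (simp add: field_simps)
  qed
  have "Cauchy X"
  proof (rule CauchyI)
    fix e :: real
    assume e: "0 < e"
    then obtain M where M: "inverse (real (Suc M)) < e\<^sup>2 / 4"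
      using reals_Archimedean[of "e\<^sup>2 / 4"] by auto
    have near: "J (X n) - m < e\<^sup>2 / 4" if "n \<ge> M" for n
    proof -
      have "inverse (real (Suc n)) \<le> inverse (real (Suc M))"
        using that by (intro le_imp_inverse_le) auto
      with X[of n] M show ?thesis by linarith
    qed
    have "norm (X p - X n) < e" if "p \<ge> M" "n \<ge> M" for p n
    proof (rule power2_less_imp_less)
      show "(norm (X p - X n))\<^sup>2 < e\<^sup>2"
        using parallelogram[of "X p" "X n"] near[OF that(1)] near[OF that(2)]
        by (simp add: field_simps)
    qed (use e in simp)
    then show "\<exists>M. \<forall>p\<ge>M. \<forall>n\<ge>M. norm (X p - X n) < e" by blast
  qed
  then obtain u where u: "X \<longlonglongrightarrow> u"
    using Cauchy_convergent convergent_def by blast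
  have "(\<lambda>n. J (X n)) \<longlonglongrightarrow> J u"
    unfolding J_def by (intro tendsto_intros f.tendsto u)
  moreover have "(\<lambda>n. m + inverse (real (Suc n))) \<longlonglongrightarrow> m + 0"
    by (intro tendsto_intros LIMSEQ_inverse_real_of_nat)
  ultimately have "J u \<le> m"
    using X by (intro LIMSEQ_le[where Y = "\<lambda>n. m + inverse (real (Suc n))"]) (auto intro: less_imp_le)
  then have minimal: "J u \<le> J v" for v
    using m_le[of v] by linarith
  have "f h = h \<bullet> u" for h
  proof (cases "h = 0")
    case True
    then show ?thesis by (simp add: f.zero)
  next
    case False
    define c where "c = h \<bullet> u - f h"
    have expand: "J (u + t *\<^sub>R h) = J u + 2 * t * c + t\<^sup>2 * (norm h)\<^sup>2" for t
      unfolding J_def c_def power2_norm_eq_inner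
      by (simp add: f.scaleR f.add inner_add inner_commute power2_eq_square algebra_simps)
    \<comment> \<open>The step \<open>t\<close> minimises the quadratic polynomial \<open>t \<mapsto> J (u + t h)\<close>.\<close>
    define t where "t = - c / (norm h)\<^sup>2"
    have "2 * t * c + t\<^sup>2 * (norm h)\<^sup>2 = - c\<^sup>2 / (norm h)\<^sup>2"
      using False by (simp add: t_def power2_eq_square)
    moreover have "0 \<le> 2 * t * c + t\<^sup>2 * (norm h)\<^sup>2"
      using minimal[of "u + t *\<^sub>R h"] expand[of t] by linarith
    ultimately have "c\<^sup>2 / (norm h)\<^sup>2 \<le> 0"
      by simp
    then have "c = 0"
      using False by (simp add: divide_le_0_iff)
    then show ?thesis by (simp add: c_def)
  qed
  then show ?thesis using that by blast
qed

section \<open>Gradients\<close>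

lemma gradient_eqI:
  assumes "GDERIV f x :> D"
  shows "gradient f x = D"
  unfolding gradient_def
proof (rule the_equality)
  fix D' assume "GDERIV f x :> D'"
  with assms have "(\<lambda>h. h \<bullet> D') = (\<lambda>h. h \<bullet> D)"
    unfolding gderiv_def using has_derivative_unique by blast
  then have "(D' - D) \<bullet> D' = (D' - D) \<bullet> D" by meson
  then have "(D' - D) \<bullet> (D' - D) = 0" by (simp add: inner_diff_right)
  then show "D' = D" by simp
qed (fact assms)

lemma GDERIV_gradient:
  fixes F :: "'a::{real_inner, complete_space} \<Rightarrow> real"
  assumes "F differentiable (at x)"
  shows "GDERIV F x :> gradient F x"
proof -
  from assms obtain F' where F': "(F has_derivative F') (at x)"
    unfolding differentiable_def by blast
  obtain u where "\<And>h. F' h = h \<bullet> u"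
    using Riesz_representation[OF has_derivative_bounded_linear[OF F']] by blast
  then have "F' = (\<lambda>h. h \<bullet> u)" by blast
  with F' have u: "GDERIV F x :> u" by (simp add: gderiv_def)
  with gradient_eqI[OF u] show ?thesis by simp
qed

lemma continuously_differentiable_imp_differentiable:
  "continuously_differentiable F \<Longrightarrow> F differentiable (at x)"
  unfolding continuously_differentiable_def differentiable_def by blast

lemma GDERIV_chain_rule_curve:
  assumes "GDERIV E (\<gamma> t) :> D" "(\<gamma> has_vector_derivative v) (at t within S)"
  shows "((\<lambda>s. E (\<gamma> s)) has_real_derivative D \<bullet> v) (at t within S)"
proof -
  have "((\<lambda>s. E (\<gamma> s)) has_derivative (\<lambda>h. (h *\<^sub>R v) \<bullet> D)) (at t within S)"
    using has_derivative_compose[OF assms(2)[unfolded has_vector_derivative_def]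
        assms(1)[unfolded gderiv_def]] .
  then show ?thesis
    unfolding has_field_derivative_def by (rule has_derivative_eq_rhs) (simp add: fun_eq_iff inner_commute)
qed

section \<open>Bregman divergences\<close>

lemma bregman_symmetrised:
  "bregman F x z + bregman F z x = (gradient F x - gradient F z) \<bullet> (x - z)"
  unfolding bregman_def by (simp add: inner_diff)

text \<open>
  Restricted to the segment from \<open>x\<close> to \<open>y\<close>, \<open>F\<close> is a convex function of one real variable, and the
  Bregman divergence is the gap between its value at \<open>1\<close> and the tangent at \<open>0\<close>.
\<close>

lemma bregman_nonneg:
  fixes F :: "'a::real_inner \<Rightarrow> real"
  assumes "convex_on UNIV F" "GDERIV F x :> gradient F x"
  shows "0 \<le> bregman F y x"
proof -
  define \<gamma> where "\<gamma> s = x + s *\<^sub>R (y - x)" for s :: real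
  have "((\<lambda>s. F (\<gamma> s)) has_real_derivative gradient F x \<bullet> (y - x)) (at 0)"
  proof (rule GDERIV_chain_rule_curve)
    show "GDERIV F (\<gamma> 0) :> gradient F x"
      using assms(2) by (simp add: \<gamma>_def)
    show "(\<gamma> has_vector_derivative y - x) (at 0)"
      unfolding \<gamma>_def by (auto intro!: derivative_eq_intros)
  qed
  moreover have "convex_on UNIV (\<lambda>s. F (\<gamma> s))"
  proof (rule convex_onI)
    fix t a b :: real
    assume "0 < t" "t < 1"
    moreover have "\<gamma> ((1 - t) *\<^sub>R a + t *\<^sub>R b) = (1 - t) *\<^sub>R \<gamma> a + t *\<^sub>R \<gamma> b"
      by (simp add: \<gamma>_def algebra_simps)
    ultimately show "F (\<gamma> ((1 - t) *\<^sub>R a + t *\<^sub>R b)) \<le> (1 - t) * F (\<gamma> a) + t * F (\<gamma> b)"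
      using convex_onD[OF assms(1), of t "\<gamma> a" "\<gamma> b"] by simp
  qed simp
  ultimately have "F (\<gamma> 1) - F (\<gamma> 0) \<ge> gradient F x \<bullet> (y - x) * (1 - 0)"
    by (intro convex_on_imp_above_tangent[where A = UNIV]) auto
  then show ?thesis
    by (simp add: bregman_def \<gamma>_def)
qed

section \<open>The strong Lyapunov property\<close>

lemma GDERIV_lyapunov:
  assumes "GDERIV F x :> gradient F x"
  shows "GDERIV (lyapunov \<mu> F z) (x, y) :> (gradient F x - gradient F z, \<mu> *\<^sub>R (y - z))"
proof -
  have F: "((\<lambda>w. F (fst w)) has_derivative (\<lambda>h. fst h \<bullet> gradient F x)) (at (x, y))"
    using has_derivative_compose[OF has_derivative_fst[OF has_derivative_ident], of F _ "(x, y)" UNIV]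
      assms by (simp add: gderiv_def)
  have "lyapunov \<mu> F z = (\<lambda>w. F (fst w) - F z - gradient F z \<bullet> (fst w - z)
          + \<mu> / 2 * ((snd w - z) \<bullet> (snd w - z)))"
    by (simp add: lyapunov_def bregman_def power2_norm_eq_inner fun_eq_iff)
  moreover have "((\<lambda>w. F (fst w) - F z - gradient F z \<bullet> (fst w - z)
          + \<mu> / 2 * ((snd w - z) \<bullet> (snd w - z)))
      has_derivative (\<lambda>h. h \<bullet> (gradient F x - gradient F z, \<mu> *\<^sub>R (y - z)))) (at (x, y))"
    by (rule F derivative_eq_intros refl)+
       (auto simp: fun_eq_iff inner_prod_def inner_diff inner_commute algebra_simps)
  ultimately show ?thesis
    unfolding gderiv_def by simp
qed

text \<open>
  To \<open>- \<nabla>E \<bullet> G\<close> the coupling \<open>x' = y - x\<close> contributes \<open>- (gradient F x - gradient F z) \<bullet> y\<close>, and the force term of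
  the second component contributes the same with the opposite sign. What survives is a symmetrised
  Bregman divergence and a term controlled by strong monotonicity.
\<close>

lemma strong_lyapunov_property:
  assumes "\<mu> > 0" "strongly_monotone \<mu> N" "gradient F z + N z = 0"
    and F: "GDERIV F x :> gradient F x"
  shows "lyapunov \<mu> F z (x, y) + bregman F z x + \<mu> / 2 * (norm (y - z))\<^sup>2
    \<le> - (gradient (lyapunov \<mu> F z) (x, y) \<bullet> vos_field \<mu> F N (x, y))"
proof -
  define g where "g = gradient F x - gradient F z"
  have "gradient F x + N y = g + (N y - N z)"
    using assms(3) by (simp add: g_def algebra_simps)
  moreover have "- (gradient (lyapunov \<mu> F z) (x, y) \<bullet> vos_field \<mu> F N (x, y))
      = - (g \<bullet> (y - x)) + (y - z) \<bullet> (gradient F x + N y)"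
    using gradient_eqI[OF GDERIV_lyapunov[OF F]] \<open>\<mu> > 0\<close>
    by (simp add: vos_field_def g_def)
  ultimately have "- (gradient (lyapunov \<mu> F z) (x, y) \<bullet> vos_field \<mu> F N (x, y))
      = - (g \<bullet> (y - x)) + (y - z) \<bullet> (g + (N y - N z))"
    by (simp only:)
  also have "\<dots> = g \<bullet> (x - z) + (N y - N z) \<bullet> (y - z)"
    by (simp add: inner_diff inner_add inner_commute algebra_simps)
  also have "\<dots> \<ge> g \<bullet> (x - z) + \<mu> * (norm (y - z))\<^sup>2"
    using assms(2) by (simp add: strongly_monotone_def)
  finally show ?thesis
    using bregman_symmetrised[of F x z] by (simp add: lyapunov_def g_def)
qed

section \<open>Exponential decay\<close>

text \<open>
  The integrating factor \<open>exp t\<close> turns the differential inequality \<open>\<phi>' \<le> - \<phi>\<close> into monotonicity of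
  \<open>exp t * \<phi> t\<close>.
\<close>

lemma Gronwall_exponential_decay:
  fixes \<phi> \<phi>' :: "real \<Rightarrow> real"
  assumes deriv: "\<And>t. t \<ge> 0 \<Longrightarrow> (\<phi> has_real_derivative \<phi>' t) (at t within {0..})"
    and decay: "\<And>t. t \<ge> 0 \<Longrightarrow> \<phi>' t \<le> - \<phi> t"
    and "t \<ge> 0"
  shows "\<phi> t \<le> \<phi> 0 * exp (- t)"
proof -
  define \<psi> where "\<psi> s = exp s * \<phi> s" for s
  have \<psi>': "(\<psi> has_real_derivative exp s * (\<phi> s + \<phi>' s)) (at s within {0..})" if "s \<ge> 0" for s
    unfolding \<psi>_def using deriv[OF that]
    by (auto intro!: derivative_eq_intros simp: algebra_simps)
  have "\<psi> t \<le> \<psi> 0"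
  proof (rule DERIV_nonpos_imp_decreasing_open[OF \<open>t \<ge> 0\<close>])
    fix s assume s: "0 < s" "s < t"
    \<comment> \<open>Away from the endpoint \<open>0\<close> the one-sided derivative is a two-sided one.\<close>
    have "at s within {0..} = at s"
      using s by (intro at_within_interior) simp
    with \<psi>'[of s] s have "(\<psi> has_real_derivative exp s * (\<phi> s + \<phi>' s)) (at s)"
      by simp
    moreover have "exp s * (\<phi> s + \<phi>' s) \<le> 0"
      using decay[of s] s by (simp add: mult_nonneg_nonpos)
    ultimately show "\<exists>d. (\<psi> has_real_derivative d) (at s) \<and> d \<le> 0" by blast
  next
    have "continuous_on {0..} \<psi>"
      using \<psi>' by (intro DERIV_continuous_on) auto
    then show "continuous_on {0..t} \<psi>"
      by (rule continuous_on_subset) auto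
  qed
  then show ?thesis
    by (simp add: \<psi>_def exp_minus field_simps)
qed

theorem theorem5p1:
  fixes \<mu> :: real
    and F :: "'a::{real_inner, complete_space} \<Rightarrow> real"
    and N :: "'a \<Rightarrow> 'a"
    and xs :: 'a
  assumes "\<mu> > 0"
    and "convex_on UNIV F"
    and "continuously_differentiable F"
    and "strongly_monotone \<mu> N"
    and "gradient F xs + N xs = 0"
  shows "(\<forall>x y. - (gradient (lyapunov \<mu> F xs) (x, y) \<bullet> vos_field \<mu> F N (x, y))
                  \<ge> lyapunov \<mu> F xs (x, y) + bregman F xs x + \<mu> / 2 * (norm (y - xs))\<^sup>2)
       \<and> (\<forall>x y. vos_solution \<mu> F N x y \<longrightarrow>
             (\<forall>t\<ge>0. lyapunov \<mu> F xs (x t, y t) \<le> lyapunov \<mu> F xs (x 0, y 0) * exp (- t)))"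
proof (intro conjI allI impI)
  let ?E = "lyapunov \<mu> F xs"
  have F: "GDERIV F x :> gradient F x" for x
    using assms(3) by (intro GDERIV_gradient continuously_differentiable_imp_differentiable)
  show strong: "- (gradient ?E (x, y) \<bullet> vos_field \<mu> F N (x, y))
      \<ge> ?E (x, y) + bregman F xs x + \<mu> / 2 * (norm (y - xs))\<^sup>2" for x y
    using strong_lyapunov_property[OF assms(1,4,5) F] .
  fix x y :: "real \<Rightarrow> 'a" and t :: real
  assume sol: "vos_solution \<mu> F N x y" and "t \<ge> 0"
  have "((\<lambda>s. ?E (x s, y s)) has_real_derivative
      gradient ?E (x s, y s) \<bullet> vos_field \<mu> F N (x s, y s)) (at s within {0..})"
    if "s \<ge> 0" for s
  proof (rule GDERIV_chain_rule_curve[where \<gamma> = "\<lambda>s. (x s, y s)"])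
    show "GDERIV ?E (x s, y s) :> gradient ?E (x s, y s)"
      using GDERIV_lyapunov[OF F] gradient_eqI[OF GDERIV_lyapunov[OF F]] by metis
    show "((\<lambda>s. (x s, y s)) has_vector_derivative vos_field \<mu> F N (x s, y s)) (at s within {0..})"
      using sol that unfolding vos_solution_def vos_field_def
      by (auto intro: has_vector_derivative_Pair)
  qed
  moreover have "gradient ?E (x s, y s) \<bullet> vos_field \<mu> F N (x s, y s) \<le> - ?E (x s, y s)" for s
  proof -
    have "0 \<le> bregman F xs (x s)"
      by (rule bregman_nonneg[OF assms(2) F])
    moreover have "0 \<le> \<mu> / 2 * (norm (y s - xs))\<^sup>2"
      using assms(1) by simp
    ultimately show ?thesis
      using strong[of "x s" "y s"] by linarith
  qed
  ultimately show "?E (x t, y t) \<le> ?E (x 0, y 0) * exp (- t)"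
    using Gronwall_exponential_decay[where \<phi> = "\<lambda>s. ?E (x s, y s)"
        and \<phi>' = "\<lambda>s. gradient ?E (x s, y s) \<bullet> vos_field \<mu> F N (x s, y s)"] \<open>t \<ge> 0\<close> by simp
qed

end
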